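(* Let $\tau:\mathbb M_n(\mathbb C)\to\mathbb M_n(\mathbb C)$ be a map satisfying: (a) $\tau(e_je_j^* )=e_je_j^*$ for $j=1,\dots,n$; (b) $\tau(\alpha A)=\overline\alpha\,\tau(A)$ for all $\alpha\in\mathbb C$ and all $A\in\mathbb M_n(\mathbb C)$; (c) $\tau(TAT^{-1})=T\tau(A)T^{-1}$ for all $A\in\mathbb M_n(\mathbb C)$ and all invertible $T\in\mathbb M_n(\mathbb C)$; (d) $\tau(A+B)=\tau(A)+\tau(B)$ whenever $A,B\in\mathbb M_n(\mathbb C)$ commute. Then $\tau(A)=A^c$ for all $A\in\mathbb M_n(\mathbb C)$. Furthermore, the map $A\mapsto A^c$ always satisfies $A^cB=BA^c$ whenever $A$ and $B$ commute, while $(A^c)^c=A$ holds exactly when $A$ is diagonalizable.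
   Context: $\mathbb M_n(\mathbb C)$ is the set of complex $n\times n$ matrices and $\{e_j\}_{j=1}^n$ is the standard basis of $\mathbb C^n$. The conjugate $A^c$ of $A\in\mathbb M_n(\mathbb C)$ is defined as follows: write $A=T(D+N)T^{-1}$ in Jordan canonical form, where $D=\mathrm{diag}(\lambda_1,\dots,\lambda_n)$ is the diagonal matrix of eigenvalues and $N$ is the nilpotent part (with possible 1's on the first superdiagonal); then $A^c:=T\overline D T^{-1}$ with $\overline D=\mathrm{diag}(\overline{\lambda_1},\dots,\overline{\lambda_n})$. *)

theory Defs
  imports
    Complex_Main
    "Jordan_Normal_Form.Jordan_Normal_Form"
    "Jordan_Normal_Form.Schur_Decomposition"
begin

text \<open>
  The list \<open>n_as\<close> of (size, eigenvalue) pairs describes the Jordan matrix \<open>J = D + N\<close>, with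
  \<open>N\<close> its superdiagonal part; hence \<open>\<lambda>\<^sub>i\<close> is the \<open>i\<close>-th diagonal entry of \<open>J\<close>, and
  \<open>S\<close> plays the role of \<open>T\<^sup>-\<^sup>1\<close>. As in the definition of \<^const>\<open>jordan_nf\<close>, blocks of size 0
  are excluded.
\<close>

definition is_jordan_conjugate :: "complex mat \<Rightarrow> complex mat \<Rightarrow> bool" where
  "is_jordan_conjugate A X \<longleftrightarrow>
     (\<exists>n_as T S. 0 \<notin> fst ` set n_as \<and> similar_mat_wit A (jordan_matrix n_as) T S \<and>
        X = T * mat_diag (dim_row A) (\<lambda>i. cnj (jordan_matrix n_as $$ (i,i))) * S)"

text \<open>
  The description operator reflects that \<open>T D' T\<^sup>-\<^sup>1\<close>, with \<open>D'\<close> the entrywise conjugate of \<open>D\<close>,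
  does not depend on the chosen Jordan decomposition of the square matrix \<open>A\<close>: it is the matrix
  acting as multiplication by the conjugate of \<open>\<lambda>\<close> on each generalized eigenspace of \<open>A\<close>.
\<close>

definition jordan_conjugate :: "complex mat \<Rightarrow> complex mat" where
  "jordan_conjugate A = (THE X. is_jordan_conjugate A X)"

definition diagonalizable_mat :: "complex mat \<Rightarrow> bool" where
  "diagonalizable_mat A \<longleftrightarrow> (\<exists>D. diagonal_mat D \<and> similar_mat A D)"

text \<open>The matrix \<open>e\<^sub>j e\<^sub>j\<^sup>*\<close>, with \<open>e\<^sub>j\<close> regarded as an \<open>n \<times> 1\<close> matrix; indices run over \<open>0, \<dots>, n - 1\<close>.\<close>

definition basis_proj :: "nat \<Rightarrow> nat \<Rightarrow> complex mat" where
  "basis_proj n j = (let e = mat_of_cols n [unit_vec n j] in e * mat_adjoint e)"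

end

theory Submission
  imports Defs "Jordan_Normal_Form.Jordan_Normal_Form_Existence"
begin

text \<open>
  Let \<open>J\<close>, \<open>K\<close> be upper triangular matrices whose nonzero off-diagonal entries only link equal
  diagonal entries. If \<open>J Y = Y K\<close>, then \<open>Y\<^sub>i\<^sub>j = 0\<close> whenever \<open>J\<^sub>i\<^sub>i \<noteq> K\<^sub>j\<^sub>j\<close>, hence \<open>Y\<close> also
  intertwines the conjugated diagonals of \<open>J\<close> and \<open>K\<close>. This gives at once that the conjugate does
  not depend on the Jordan decomposition and that it commutes with whatever commutes with \<open>A\<close>.

  For the characterization, write \<open>A = T (D + N) T\<^sup>-\<^sup>1\<close> with \<open>D N = N D\<close>. Scaling and additivity
  give \<open>\<tau> D\<close>. Finally \<open>2\<i> N\<close> is similar to \<open>N\<close> through \<open>diag (1, 2\<i>, (2\<i>)\<^sup>2, \<dots>)\<close>, so each entry satisfies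
  \<open>cnj (2\<i>) * (\<tau> N)\<^sub>i\<^sub>j = (2\<i>)\<^sup>j\<^sup>-\<^sup>i * (\<tau> N)\<^sub>i\<^sub>j\<close>; comparing moduli leaves only \<open>j = i + 1\<close>, where
  \<open>cnj (2\<i>) \<noteq> 2\<i>\<close>, and \<open>\<tau> N = 0\<close>.
\<close>

section \<open>Eigen-triangular matrices and their intertwiners\<close>

definition eigen_triangular :: "'a::zero mat \<Rightarrow> bool" where
  "eigen_triangular J \<longleftrightarrow>
     (\<forall>i<dim_row J. \<forall>j<dim_col J. J $$ (i,j) \<noteq> 0 \<longrightarrow> i \<le> j \<and> J $$ (i,i) = J $$ (j,j))"

lemma eigen_triangularD:
  assumes "eigen_triangular J" "J \<in> carrier_mat n n" "i < n" "j < n" "J $$ (i,j) \<noteq> 0"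
  shows "i \<le> j" "J $$ (i,i) = J $$ (j,j)"
  using assms unfolding eigen_triangular_def by auto

text \<open>Thus diagonalizations are covered by the same results as Jordan decompositions. This is
  what allows a second conjugation, and the conjugate of a diagonalizable matrix to be read off its
  diagonal form.\<close>

lemma eigen_triangular_diagonal:
  assumes "diagonal_mat D" "D \<in> carrier_mat n n"
  shows "eigen_triangular D"
  using assms unfolding eigen_triangular_def diagonal_mat_def
  by (metis order_refl)

lemma index_mult_mat_sum:
  assumes "A \<in> carrier_mat n m" "B \<in> carrier_mat m l" "i < n" "j < l"
  shows "(A * B) $$ (i,j) = (\<Sum>k<m. A $$ (i,k) * B $$ (k,j))"
  using assms by (auto simp: scalar_prod_def lessThan_atLeast0 intro!: sum.cong)

lemma sum_eq_single:
  assumes "finite A" "i \<in> A" "\<And>k. k \<in> A \<Longrightarrow> k \<noteq> i \<Longrightarrow> f k = 0"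
  shows "sum f A = f i"
  using assms by (simp add: sum.remove[of A i])

text \<open>In the (i,j) entry of \<open>J * Y = Y * K\<close>, every term other than the two with
  diagonal factors vanishes by induction. What is left is
  \<open>J $$ (i,i) * Y $$ (i,j) = Y $$ (i,j) * K $$ (j,j)\<close>, and the factor
  \<open>Y $$ (i,j)\<close> cannot be nonzero.\<close>

lemma eigen_triangular_intertwine_zero:
  fixes J K Y :: "'a::idom mat"
  assumes J: "J \<in> carrier_mat n n" "eigen_triangular J"
    and K: "K \<in> carrier_mat n n" "eigen_triangular K"
    and Y: "Y \<in> carrier_mat n n" and JY: "J * Y = Y * K"
    and "i < n" "j < n" "J $$ (i,i) \<noteq> K $$ (j,j)"
  shows "Y $$ (i,j) = 0"
  using assms(7-9)
\<comment> \<open>The measure drops when moving down a column of \<open>Y\<close> (a nonzero entry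
  of \<open>J\<close>) or left along a row (a nonzero entry of \<open>K\<close>). Either move keeps
  the relevant diagonal value, so the two values stay distinct.\<close>
proof (induction "(n - i) + j" arbitrary: i j rule: less_induct)
  case less
  have "J $$ (i,k) * Y $$ (k,j) = 0" if k: "k < n" "k \<noteq> i" for k
  proof (cases "J $$ (i,k) = 0")
    case False
    note * = eigen_triangularD[OF J(2,1) less.prems(1) k(1) False]
    then have "(n - k) + j < (n - i) + j" using k less.prems by linarith
    then show ?thesis using less.hyps[of k j] * less.prems k by simp
  qed simp
  then have left: "(J * Y) $$ (i,j) = J $$ (i,i) * Y $$ (i,j)"
    unfolding index_mult_mat_sum[OF J(1) Y less.prems(1,2)]
    by (intro sum_eq_single) (use less.prems in simp_all)
  have "Y $$ (i,k) * K $$ (k,j) = 0" if k: "k < n" "k \<noteq> j" for k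
  proof (cases "K $$ (k,j) = 0")
    case False
    note * = eigen_triangularD[OF K(2,1) k(1) less.prems(2) False]
    then have "(n - i) + k < (n - i) + j" using k less.prems by linarith
    then show ?thesis using less.hyps[of i k] * less.prems k by simp
  qed simp
  then have right: "(Y * K) $$ (i,j) = Y $$ (i,j) * K $$ (j,j)"
    unfolding index_mult_mat_sum[OF Y K(1) less.prems(1,2)]
    by (intro sum_eq_single) (use less.prems in simp_all)
  from left right JY less.prems(3) show ?case by (simp add: mult.commute)
qed

text \<open>Arbitrary \<open>g\<close> is allowed because two instances occur: \<open>cnj\<close>
  gives the conjugate, and \<open>id\<close> gives the diagonal part, which is what conjugating
  twice produces.\<close>

definition map_diag_mat :: "('a \<Rightarrow> 'b::zero) \<Rightarrow> 'a mat \<Rightarrow> 'b mat" where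
  "map_diag_mat g J = mat_diag (dim_row J) (\<lambda>i. g (J $$ (i,i)))"

lemma map_diag_mat_carrier [simp]:
  "J \<in> carrier_mat n m \<Longrightarrow> map_diag_mat g J \<in> carrier_mat n n"
  unfolding map_diag_mat_def by auto

lemma diagonal_map_diag_mat [simp]: "diagonal_mat (map_diag_mat g J)"
  unfolding map_diag_mat_def diagonal_mat_def mat_diag_def by auto

lemma eigen_triangular_intertwine_map_diag:
  fixes J K Y :: "'a::idom mat"
  assumes J: "J \<in> carrier_mat n n" "eigen_triangular J"
    and K: "K \<in> carrier_mat n n" "eigen_triangular K"
    and Y: "Y \<in> carrier_mat n n" and JY: "J * Y = Y * K"
  shows "map_diag_mat g J * Y = Y * map_diag_mat g K"
proof -
  have "g (J $$ (i,i)) * Y $$ (i,j) = Y $$ (i,j) * g (K $$ (j,j))" if "i < n" "j < n" for i j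
    using eigen_triangular_intertwine_zero[OF assms that]
    by (cases "J $$ (i,i) = K $$ (j,j)") (auto simp: mult.commute)
  then show ?thesis
    using J(1) K(1) unfolding map_diag_mat_def
    by (auto simp: mat_diag_mult_left[OF Y] mat_diag_mult_right[OF Y] intro!: cong_mat)
qed

text \<open>In the bases of the two decompositions, \<open>X\<close> becomes
  \<open>S * X * T'\<close>, which intertwines \<open>J\<close> and \<open>K\<close>. Taking
  \<open>X\<close> to be the identity and \<open>B = A\<close> yields independence of the
  decomposition; taking \<open>B = A\<close> and any \<open>X\<close> commuting with
  \<open>A\<close> yields the commutation claim.\<close>

lemma similar_map_diag_intertwine:
  fixes A B X :: "'a::idom mat"
  assumes A: "A \<in> carrier_mat n n" "similar_mat_wit A J T S" "eigen_triangular J"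
    and B: "B \<in> carrier_mat n n" "similar_mat_wit B K T' S'" "eigen_triangular K"
    and X: "X \<in> carrier_mat n n" and AX: "A * X = X * B"
  shows "(T * map_diag_mat g J * S) * X = X * (T' * map_diag_mat g K * S')"
proof -
  note a = similar_mat_witD2[OF A(1,2)] and b = similar_mat_witD2[OF B(1,2)]
  \<comment> \<open>Once products are nested to the right, \<open>P * Q\<close> is no longer a
    subterm, so inverse pairs are cancelled in front of a further factor.\<close>
  have cancel: "P * (Q * M) = M"
    if "P * Q = 1\<^sub>m n" "P \<in> carrier_mat n n" "Q \<in> carrier_mat n n" "M \<in> carrier_mat n n"
    for P Q M :: "'a mat"
    using that by (subst assoc_mult_mat[of P n n Q n M n, symmetric]) auto
  note collapse = cancel[OF a(1,6,7)] cancel[OF a(2,7,6)] cancel[OF b(1,6,7)] cancel[OF b(2,7,6)]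
  note [simp] = assoc_mult_mat[of _ n n _ n _ n] mult_carrier_mat[of _ n n _ n]
    right_mult_one_mat[of _ n n] a(5-7) b(5-7) X
    map_diag_mat_carrier[of _ n n]
  have TAX: "T * (J * (S * X)) = X * (T' * (K * S'))"
    using AX unfolding a(3) b(3) by simp
  have "J * (S * X * T') = S * (T * (J * (S * X))) * T'"
    by (simp add: collapse)
  also have "\<dots> = (S * X * T') * K"
    unfolding TAX using b(2) by (simp add: collapse)
  finally have "map_diag_mat g J * (S * X * T') = (S * X * T') * map_diag_mat g K"
    by (intro eigen_triangular_intertwine_map_diag[of _ n]) (use assms in auto)
  then have "T * (map_diag_mat g J * (S * X * T')) * S' = T * ((S * X * T') * map_diag_mat g K) * S'"
    by simp
  then show ?thesis using b(1) by (simp add: collapse)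
qed

section \<open>Jordan decompositions and well-definedness of the conjugate\<close>

lemma jordan_matrix_entry:
  assumes "i < sum_list (map fst n_as)" "j < sum_list (map fst n_as)"
    and "jordan_matrix n_as $$ (i,j) \<noteq> 0"
  shows "(j = i \<or> j = Suc i) \<and> jordan_matrix n_as $$ (i,i) = jordan_matrix n_as $$ (j,j)"
  using assms
proof (induction n_as arbitrary: i j)
  case (Cons na n_as)
  obtain m a where na: "na = (m,a)" by force
  define M where "M = sum_list (map fst n_as)"
  let ?J = "jordan_matrix ((m,a) # n_as)"
  \<comment> \<open>The test \<open>j < m\<close> keeps the superdiagonal 1 from crossing into the
    next block, where the eigenvalue may differ.\<close>
  have index: "?J $$ (i,j) =
      (if i < m then if j = i then a else if j = Suc i \<and> j < m then 1 else 0
       else if j < m then 0 else jordan_matrix n_as $$ (i - m, j - m))"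
    if "i < m + M" "j < m + M" for i j
    using that unfolding jordan_matrix_Cons by (subst index_mat_four_block(1)) (auto simp: M_def)
  have ij: "i < m + M" "j < m + M" "?J $$ (i,j) \<noteq> 0"
    using Cons.prems by (auto simp: na M_def)
  show ?case
  proof (cases "i < m")
    case True
    then show ?thesis
      using ij(3) unfolding na index[OF ij(1,2)] index[OF ij(1,1)] index[OF ij(2,2)]
      by (auto split: if_splits)
  next
    case False
    then have j: "\<not> j < m" and nz: "jordan_matrix n_as $$ (i - m, j - m) \<noteq> 0"
      using ij(3) unfolding index[OF ij(1,2)] by (auto split: if_splits)
    have "i - m < M" "j - m < M" using False j ij by auto
    from Cons.IH[OF this[unfolded M_def] nz] False j show ?thesis
      unfolding na index[OF ij(1,1)] index[OF ij(2,2)] by auto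
  qed
qed simp

lemma eigen_triangular_jordan_matrix: "eigen_triangular (jordan_matrix n_as)"
  unfolding eigen_triangular_def using jordan_matrix_entry by fastforce

lemma jordan_decomposition_exists:
  fixes A :: "complex mat"
  assumes A: "A \<in> carrier_mat n n"
  obtains n_as T S where "0 \<notin> fst ` set n_as" "similar_mat_wit A (jordan_matrix n_as) T S"
    "jordan_matrix n_as \<in> carrier_mat n n"
proof -
  obtain as where "char_poly A = (\<Prod>a\<leftarrow>as. [:- a, 1:])"
    using char_poly_factorized[OF A] by blast
  from jordan_nf_exists[OF A this] obtain n_as T S
    where *: "0 \<notin> fst ` set n_as" "similar_mat_wit A (jordan_matrix n_as) T S"
    unfolding jordan_nf_def similar_mat_def by blast
  from that[OF * similar_mat_witD2(5)[OF A *(2)]] show ?thesis .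
qed

text \<open>The identity matrix intertwines \<open>A\<close> with itself, so any two decompositions
  give the same result. One of them need only be eigen-triangular, which admits diagonalizations of
  \<open>A\<close> as well.\<close>

lemma is_jordan_conjugate_eq:
  assumes A: "A \<in> carrier_mat n n" and wit: "similar_mat_wit A J T S" "eigen_triangular J"
    and X: "is_jordan_conjugate A X"
  shows "X = T * map_diag_mat cnj J * S"
proof -
  note a = similar_mat_witD2[OF A wit(1)]
  obtain n_as T' S' where wit': "similar_mat_wit A (jordan_matrix n_as) T' S'"
    and X_eq: "X = T' * map_diag_mat cnj (jordan_matrix n_as) * S'"
    using X A unfolding is_jordan_conjugate_def map_diag_mat_def
    by (metis carrier_matD(1) similar_mat_witD2(5))
  note b = similar_mat_witD2[OF A wit']
  have "X * 1\<^sub>m n = 1\<^sub>m n * (T * map_diag_mat cnj J * S)"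
    unfolding X_eq
    by (rule similar_map_diag_intertwine[OF A wit' eigen_triangular_jordan_matrix A wit])
      (use A in auto)
  moreover have "X \<in> carrier_mat n n" "T * map_diag_mat cnj J * S \<in> carrier_mat n n"
    unfolding X_eq using a(5-7) b(5-7) by (auto intro!: mult_carrier_mat)
  ultimately show ?thesis by (metis left_mult_one_mat right_mult_one_mat)
qed

lemma jordan_conjugate_eq:
  assumes A: "A \<in> carrier_mat n n" and wit: "similar_mat_wit A J T S" "eigen_triangular J"
  shows "jordan_conjugate A = T * map_diag_mat cnj J * S"
proof -
  obtain n_as T' S' where "0 \<notin> fst ` set n_as" "similar_mat_wit A (jordan_matrix n_as) T' S'"
    using jordan_decomposition_exists[OF A] .
  then have "\<exists>X. is_jordan_conjugate A X"
    unfolding is_jordan_conjugate_def by blast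
  then show ?thesis
    unfolding jordan_conjugate_def using is_jordan_conjugate_eq[OF assms] by (metis (mono_tags) theI')
qed

section \<open>The double conjugate, commutation and diagonalizability\<close>

lemma similar_mat_wit_jordan_conjugate:
  assumes A: "A \<in> carrier_mat n n" and wit: "similar_mat_wit A J T S" "eigen_triangular J"
  shows "similar_mat_wit (jordan_conjugate A) (map_diag_mat cnj J) T S"
  using similar_mat_witD2[OF A wit(1)] unfolding jordan_conjugate_eq[OF assms]
  by (intro similar_mat_witI[of _ _ n]) (auto intro!: mult_carrier_mat)

lemma map_diag_mat_cnj_cnj:
  "map_diag_mat cnj (map_diag_mat cnj D) = map_diag_mat id D"
  unfolding map_diag_mat_def mat_diag_def by (intro eq_matI) auto

lemma map_diag_mat_id_diagonal:
  assumes "diagonal_mat D" "D \<in> carrier_mat n n"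
  shows "map_diag_mat id D = D"
  using assms unfolding map_diag_mat_def mat_diag_def diagonal_mat_def by (intro eq_matI) auto

text \<open>The conjugate is already diagonal in the basis \<open>T\<close>, so the second
  conjugation only undoes \<open>cnj\<close> on that diagonal. The superdiagonal part of a Jordan
  matrix \<open>J\<close> is lost: the double conjugate is the diagonalizable part of
  \<open>A\<close>.\<close>

lemma jordan_conjugate_twice:
  assumes A: "A \<in> carrier_mat n n" and wit: "similar_mat_wit A J T S" "eigen_triangular J"
  shows "similar_mat_wit (jordan_conjugate (jordan_conjugate A)) (map_diag_mat id J) T S"
proof -
  note conj = similar_mat_wit_jordan_conjugate[OF assms]
  have carr: "jordan_conjugate A \<in> carrier_mat n n" "map_diag_mat cnj J \<in> carrier_mat n n"
    using similar_mat_witD2[OF A wit(1)] unfolding jordan_conjugate_eq[OF assms]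
    by (auto intro!: mult_carrier_mat)
  show ?thesis
    using similar_mat_wit_jordan_conjugate[OF carr(1) conj
        eigen_triangular_diagonal[OF diagonal_map_diag_mat carr(2)]]
    unfolding map_diag_mat_cnj_cnj .
qed

lemma jordan_conjugate_commute:
  assumes A: "A \<in> carrier_mat n n" and B: "B \<in> carrier_mat n n" and AB: "A * B = B * A"
  shows "jordan_conjugate A * B = B * jordan_conjugate A"
proof -
  obtain n_as T S where wit: "similar_mat_wit A (jordan_matrix n_as) T S"
    using jordan_decomposition_exists[OF A] .
  note J = eigen_triangular_jordan_matrix
  show ?thesis
    unfolding jordan_conjugate_eq[OF A wit J]
    by (rule similar_map_diag_intertwine[OF A wit J A wit J B AB])
qed

lemma jordan_conjugate_involutive_iff:
  assumes A: "A \<in> carrier_mat n n"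
  shows "jordan_conjugate (jordan_conjugate A) = A \<longleftrightarrow> diagonalizable_mat A"
proof
  assume inv: "jordan_conjugate (jordan_conjugate A) = A"
  obtain n_as T S where wit: "similar_mat_wit A (jordan_matrix n_as) T S"
    using jordan_decomposition_exists[OF A] .
  show "diagonalizable_mat A"
    using jordan_conjugate_twice[OF A wit eigen_triangular_jordan_matrix] diagonal_map_diag_mat
    unfolding inv diagonalizable_mat_def similar_mat_def by blast
next
  assume "diagonalizable_mat A"
  then obtain D T S where D: "diagonal_mat D" and wit: "similar_mat_wit A D T S"
    unfolding diagonalizable_mat_def similar_mat_def by blast
  note a = similar_mat_witD2[OF A wit]
  have "similar_mat_wit (jordan_conjugate (jordan_conjugate A)) D T S"
    using jordan_conjugate_twice[OF A wit eigen_triangular_diagonal[OF D a(5)]]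
    unfolding map_diag_mat_id_diagonal[OF D a(5)] .
  then have "jordan_conjugate (jordan_conjugate A) = T * D * S"
    unfolding similar_mat_wit_def by metis
  with a(3) show "jordan_conjugate (jordan_conjugate A) = A" by simp
qed

section \<open>Maps with properties (a) to (d)\<close>

lemma basis_proj_eq_mat_diag:
  assumes "j < n"
  shows "basis_proj n j = mat_diag n (\<lambda>i. if i = j then 1 else 0)"
  using assms unfolding basis_proj_def mat_adjoint_def mat_diag_def Let_def
  by (intro eq_matI) (auto simp: scalar_prod_def mat_of_cols_def mat_of_rows_def cols_def)

locale commuting_additive_conjugation =
  fixes n :: nat and \<tau> :: "complex mat \<Rightarrow> complex mat"
  assumes carrier: "A \<in> carrier_mat n n \<Longrightarrow> \<tau> A \<in> carrier_mat n n"
    and basis_proj: "j < n \<Longrightarrow> \<tau> (basis_proj n j) = basis_proj n j"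
    and smult: "A \<in> carrier_mat n n \<Longrightarrow> \<tau> (\<alpha> \<cdot>\<^sub>m A) = cnj \<alpha> \<cdot>\<^sub>m \<tau> A"
    and similar: "\<lbrakk>A \<in> carrier_mat n n; T \<in> carrier_mat n n; S \<in> carrier_mat n n;
      T * S = 1\<^sub>m n; S * T = 1\<^sub>m n\<rbrakk> \<Longrightarrow> \<tau> (T * A * S) = T * \<tau> A * S"
    and add: "\<lbrakk>A \<in> carrier_mat n n; B \<in> carrier_mat n n; A * B = B * A\<rbrakk>
      \<Longrightarrow> \<tau> (A + B) = \<tau> A + \<tau> B"
begin

lemma zero: "\<tau> (0\<^sub>m n n) = 0\<^sub>m n n"
proof -
  have "0 \<cdot>\<^sub>m M = 0\<^sub>m n n" if "M \<in> carrier_mat n n" for M :: "complex mat"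
    using that by (auto intro!: eq_matI)
  then show ?thesis
    using smult[of "0\<^sub>m n n" 0] carrier[of "0\<^sub>m n n"] by simp
qed

lemma mat_diag: "\<tau> (mat_diag n f) = mat_diag n (\<lambda>i. cnj (f i))"
proof -
  \<comment> \<open>The diagonal is built up one entry at a time. All summands are diagonal, hence
    commute, so \<open>add\<close> applies at each stage.\<close>
  have "\<tau> (mat_diag n (\<lambda>i. if i < k then f i else 0)) = mat_diag n (\<lambda>i. if i < k then cnj (f i) else 0)"
    if "k \<le> n" for k
    using that
  proof (induction k)
    case 0
    have "mat_diag n (\<lambda>i. 0) = (0\<^sub>m n n :: complex mat)" by (auto simp: mat_diag_def)
    then show ?case using zero by simp
  next
    case (Suc k)
    have split: "mat_diag n (\<lambda>i. if i < Suc k then g i else 0)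
        = mat_diag n (\<lambda>i. if i < k then g i else 0) + g k \<cdot>\<^sub>m basis_proj n k" for g :: "nat \<Rightarrow> complex"
      using Suc.prems
      by (auto simp: basis_proj_eq_mat_diag mat_diag_def less_Suc_eq intro!: eq_matI)
    have e: "basis_proj n k \<in> carrier_mat n n"
      using Suc.prems by (simp add: basis_proj_eq_mat_diag)
    have ge: "g k \<cdot>\<^sub>m basis_proj n k = mat_diag n (\<lambda>i. if i = k then g k else 0)" for g :: "nat \<Rightarrow> complex"
      using Suc.prems by (auto simp: basis_proj_eq_mat_diag mat_diag_def intro!: eq_matI)
    have "\<tau> (mat_diag n (\<lambda>i. if i < Suc k then f i else 0))
        = \<tau> (mat_diag n (\<lambda>i. if i < k then f i else 0)) + \<tau> (f k \<cdot>\<^sub>m basis_proj n k)"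
      unfolding split by (intro add) (auto simp: ge mult.commute)
    also have "\<dots> = mat_diag n (\<lambda>i. if i < Suc k then cnj (f i) else 0)"
      using Suc smult[OF e] basis_proj[of k] split[of "\<lambda>i. cnj (f i)"] by simp
    finally show ?case .
  qed
  moreover have "mat_diag n (\<lambda>i. if i < n then g i else 0) = mat_diag n g" for g :: "nat \<Rightarrow> complex"
    by (auto simp: mat_diag_def intro!: eq_matI)
  ultimately show ?thesis by (metis order_refl)
qed

lemma superdiagonal:
  assumes N: "N \<in> carrier_mat n n"
    and super: "\<And>i j. \<lbrakk>i < n; j < n; N $$ (i,j) \<noteq> 0\<rbrakk> \<Longrightarrow> j = Suc i"
  shows "\<tau> N = 0\<^sub>m n n"
proof -
  \<comment> \<open>Two properties of this number matter: its modulus is not 1, so its powers have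
    distinct moduli, and it is not real.\<close>
  define \<alpha> where "\<alpha> = 2 * \<i>"
  define R where "R = mat_diag n (\<lambda>i. \<alpha> ^ i)"
  define R' where "R' = mat_diag n (\<lambda>i. inverse (\<alpha> ^ i))"
  have \<alpha>: "\<alpha> \<noteq> 0" "norm \<alpha> = 2" "cnj \<alpha> = - \<alpha>"
    unfolding \<alpha>_def by (auto simp: norm_mult)
  have R: "R \<in> carrier_mat n n" "R' \<in> carrier_mat n n" "R' * R = 1\<^sub>m n" "R * R' = 1\<^sub>m n"
    unfolding R_def R'_def using \<alpha>(1) by auto
  have entries: "R' * M * R = Matrix.mat n n (\<lambda>(i,j). inverse (\<alpha> ^ i) * M $$ (i,j) * \<alpha> ^ j)"
    if "M \<in> carrier_mat n n" for M
    unfolding R_def R'_def mat_diag_mult_left[OF that]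
    by (subst mat_diag_mult_right[of _ n n]) (auto intro!: eq_matI)
  \<comment> \<open>Conjugation by \<open>R\<close> scales the (i,j) entry by \<alpha> to the power
    j - i, which is \<alpha> itself wherever \<open>N\<close> is nonzero.\<close>
  have "\<alpha> \<cdot>\<^sub>m N = R' * N * R"
    unfolding entries[OF N]
  proof (intro eq_matI)
    fix i j assume "i < dim_row (Matrix.mat n n (\<lambda>(i,j). inverse (\<alpha> ^ i) * N $$ (i,j) * \<alpha> ^ j))"
      "j < dim_col (Matrix.mat n n (\<lambda>(i,j). inverse (\<alpha> ^ i) * N $$ (i,j) * \<alpha> ^ j))"
    then show "(\<alpha> \<cdot>\<^sub>m N) $$ (i,j) = Matrix.mat n n (\<lambda>(i,j). inverse (\<alpha> ^ i) * N $$ (i,j) * \<alpha> ^ j) $$ (i,j)"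
      using N super[of i j] \<alpha>(1) by (cases "N $$ (i,j) = 0") auto
  qed (use N in auto)
  then have eq: "cnj \<alpha> \<cdot>\<^sub>m \<tau> N = R' * \<tau> N * R"
    using smult[OF N, of \<alpha>] similar[OF N R(2,1,3,4)] by simp
  show ?thesis
  proof (intro eq_matI)
    fix i j assume "i < dim_row (0\<^sub>m n n :: complex mat)" "j < dim_col (0\<^sub>m n n :: complex mat)"
    then have ij: "i < n" "j < n" by auto
    define x where "x = \<tau> N $$ (i,j)"
    have "(cnj \<alpha> \<cdot>\<^sub>m \<tau> N) $$ (i,j) = (R' * \<tau> N * R) $$ (i,j)"
      unfolding eq ..
    then have "cnj \<alpha> * x = inverse (\<alpha> ^ i) * x * \<alpha> ^ j"
      unfolding entries[OF carrier[OF N]] using ij carrier[OF N] by (simp add: x_def)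
    then have "x * - (\<alpha> ^ Suc i) = x * \<alpha> ^ j"
      using \<alpha>(1,3) by (simp add: field_simps)
    then have x: "x = 0 \<or> - (\<alpha> ^ Suc i) = \<alpha> ^ j"
      unfolding mult_cancel_left .
    \<comment> \<open>Moduli force \<open>j = Suc i\<close>, and then the sign coming from
      \<open>cnj \<alpha> = - \<alpha>\<close> gives the contradiction.\<close>
    have "- (\<alpha> ^ Suc i) \<noteq> \<alpha> ^ j"
    proof
      assume h: "- (\<alpha> ^ Suc i) = \<alpha> ^ j"
      then have "norm (\<alpha> ^ Suc i) = norm (\<alpha> ^ j)" by (metis norm_minus_cancel)
      then have "(2::real) ^ Suc i = 2 ^ j" unfolding norm_power \<alpha>(2) .
      then have "j = Suc i" by (subst (asm) power_inject_exp) simp_all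
      with h \<alpha>(1) show False by (simp del: power_Suc)
    qed
    with x show "\<tau> N $$ (i,j) = 0\<^sub>m n n $$ (i,j)" using ij x_def by simp
  qed (use carrier[OF N] in auto)
qed

lemma eq_jordan_conjugate:
  assumes A: "A \<in> carrier_mat n n"
  shows "\<tau> A = jordan_conjugate A"
proof -
  obtain n_as T S where wit: "similar_mat_wit A (jordan_matrix n_as) T S"
    and J: "jordan_matrix n_as \<in> carrier_mat n n"
    using jordan_decomposition_exists[OF A] .
  note a = similar_mat_witD2[OF A wit]
  define J where "J = jordan_matrix n_as"
  define D where "D = mat_diag n (\<lambda>i. J $$ (i,i))"
  define N where "N = Matrix.mat n n (\<lambda>(i,j). if i = j then 0 else J $$ (i,j))"
  have Jc: "J \<in> carrier_mat n n" using J J_def by simp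
  have D: "D \<in> carrier_mat n n" and N: "N \<in> carrier_mat n n" unfolding D_def N_def by auto
  have size: "sum_list (map fst n_as) = n" using J by (metis carrier_matD(1) jordan_matrix_dim(1))
  have entry: "(j = i \<or> j = Suc i) \<and> J $$ (i,i) = J $$ (j,j)" 
    if "i < n" "j < n" "J $$ (i,j) \<noteq> 0" for i j
    using jordan_matrix_entry[of i n_as j] that unfolding J_def size by blast
  have JDN: "J = D + N"
    using Jc unfolding D_def N_def mat_diag_def by (intro eq_matI) auto
  \<comment> \<open>A nonzero entry of \<open>N\<close> lies inside one Jordan block, where the
    diagonal is constant; hence \<open>D\<close> and \<open>N\<close> commute and \<open>add\<close>
    can split \<open>J\<close>.\<close>
  have "J $$ (i,i) * N $$ (i,j) = N $$ (i,j) * J $$ (j,j)" if "i < n" "j < n" for i j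
    using entry[OF that] that unfolding N_def by auto
  then have DN: "D * N = N * D"
    unfolding D_def mat_diag_mult_left[OF N] mat_diag_mult_right[OF N] by (intro cong_mat) auto
  have "\<tau> N = 0\<^sub>m n n"
    by (rule superdiagonal[OF N]) (use entry in \<open>auto simp: N_def split: if_splits\<close>)
  then have "\<tau> J = \<tau> D"
    unfolding JDN add[OF D N DN] using carrier[OF D] by simp
  also have "\<dots> = map_diag_mat cnj J"
    using Jc unfolding D_def mat_diag map_diag_mat_def by simp
  finally have "\<tau> (T * J * S) = T * map_diag_mat cnj J * S"
    using similar[OF Jc a(6,7,1,2)] by simp
  then show ?thesis
    using jordan_conjugate_eq[OF A wit eigen_triangular_jordan_matrix] a(3) unfolding J_def by simp
qed

end

theorem proposition2p6:
  fixes n :: nat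
  shows
    "(\<forall>\<tau> :: complex mat \<Rightarrow> complex mat.
        \<tau> \<in> carrier_mat n n \<rightarrow> carrier_mat n n \<longrightarrow>
        (\<forall>j<n. \<tau> (basis_proj n j) = basis_proj n j) \<longrightarrow>
        (\<forall>\<alpha>. \<forall>A\<in>carrier_mat n n. \<tau> (\<alpha> \<cdot>\<^sub>m A) = cnj \<alpha> \<cdot>\<^sub>m \<tau> A) \<longrightarrow>
        (\<forall>A\<in>carrier_mat n n. \<forall>T\<in>carrier_mat n n. \<forall>S\<in>carrier_mat n n.
           inverts_mat T S \<and> inverts_mat S T \<longrightarrow> \<tau> (T * A * S) = T * \<tau> A * S) \<longrightarrow>
        (\<forall>A\<in>carrier_mat n n. \<forall>B\<in>carrier_mat n n.
           A * B = B * A \<longrightarrow> \<tau> (A + B) = \<tau> A + \<tau> B) \<longrightarrow>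
        (\<forall>A\<in>carrier_mat n n. \<tau> A = jordan_conjugate A))
     \<and> (\<forall>A\<in>carrier_mat n n. \<forall>B\<in>carrier_mat n n.
           A * B = B * A \<longrightarrow> jordan_conjugate A * B = B * jordan_conjugate A)
     \<and> (\<forall>A\<in>carrier_mat n n.
           jordan_conjugate (jordan_conjugate A) = A \<longleftrightarrow> diagonalizable_mat A)"
proof (intro conjI allI impI ballI)
  fix \<tau> :: "complex mat \<Rightarrow> complex mat" and A :: "complex mat"
  assume "\<tau> \<in> carrier_mat n n \<rightarrow> carrier_mat n n"
    and "\<forall>j<n. \<tau> (basis_proj n j) = basis_proj n j"
    and "\<forall>\<alpha>. \<forall>A\<in>carrier_mat n n. \<tau> (\<alpha> \<cdot>\<^sub>m A) = cnj \<alpha> \<cdot>\<^sub>m \<tau> A"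
    and "\<forall>A\<in>carrier_mat n n. \<forall>T\<in>carrier_mat n n. \<forall>S\<in>carrier_mat n n.
      inverts_mat T S \<and> inverts_mat S T \<longrightarrow> \<tau> (T * A * S) = T * \<tau> A * S"
    and "\<forall>A\<in>carrier_mat n n. \<forall>B\<in>carrier_mat n n. A * B = B * A \<longrightarrow> \<tau> (A + B) = \<tau> A + \<tau> B"
    and A: "A \<in> carrier_mat n n"
  then interpret commuting_additive_conjugation n \<tau>
    by unfold_locales (auto simp: inverts_mat_def)
  show "\<tau> A = jordan_conjugate A" by (rule eq_jordan_conjugate[OF A])
qed (use jordan_conjugate_commute jordan_conjugate_involutive_iff in blast)+

end
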